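(* Let $P$ be an ergodic Markov kernel on a finite set $\mathcal X$, $n=|\mathcal X|\ge3$, reversible with respect to the strictly positive probability distribution $\pi$, and let $k\in\{2,\ldots,n-1\}$. Let $\eta_1\le\cdots\le\eta_{n-1}$ be the eigenvalues of $P^2$ on $\ell_0^2(\pi)$ with multiplicity and $\phi_1,\ldots,\phi_{n-1}$ the fixed corresponding $\pi$-orthonormal eigenbasis. Let $F_\star$ and $\beta_j^\star$ ($1\le j\le n-1$) be given by either of the following: (i) for an integer $T\ge1$ and weights $w_1,\ldots,w_T\ge0$ not all zero, $F_\star(\mathcal O)=\sum_{t=1}^Tw_t\|G_{\mathcal O}P^t-\Pi\|_{F,\pi}^2$ and $\beta_j^\star=\sum_{t=1}^Tw_t\eta_j^t$; (ii) for $0\le\gamma<1$, $F_\star(\mathcal O)=\sum_{t=1}^\infty\gamma^{t-1}\|G_{\mathcal O}P^t-\Pi\|_{F,\pi}^2$ and $\beta_j^\star=\eta_j/(1-\gamma\eta_j)$. Put $$L_\star=\sum_{j=1}^{k-1}\beta_j^\star,\qquad g_\star=\beta_k^\star-\beta_{k-1}^\star,\qquad W_\star=\beta_{n-1}^\star-\beta_1^\star.$$ Then for every partition $\mathcal O$ of $\mathcal X$ into $k$ nonempty blocks, with $\delta(\mathcal O)=\sum_{j=1}^{k-1}\|(I-G_{\mathcal O})\phi_j\|_\pi^2$, $$L_\star+g_\star\,\delta(\mathcal O)\le F_\star(\mathcal O)\le L_\star+W_\star\,\delta(\mathcal O).$$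
   Context: $\pi(x)>0$ for all $x\in\mathcal X$. $\ell^2(\pi)$ is the space of real functions on $\mathcal X$ with $\langle f,g\rangle_\pi=\sum_x\pi(x)f(x)g(x)$ and norm $\|\cdot\|_\pi$; $\ell^2_0(\pi)=\{f:\sum_x\pi(x)f(x)=0\}$. Kernels act by $(Pf)(x)=\sum_yP(x,y)f(y)$. Ergodic means irreducible and aperiodic; reversible means $\pi(x)P(x,y)=\pi(y)P(y,x)$ for all $x,y$. The eigenbasis $\phi_1,\ldots,\phi_{n-1}$ of $\ell_0^2(\pi)$ satisfies $P^2\phi_j=\eta_j\phi_j$ and is chosen so that each $\phi_j$ is also an eigenfunction of $P$. $\Pi(x,y)=\pi(y)$. The Gibbs kernel of $\mathcal O=\{O_1,\ldots,O_k\}$ is $G_{\mathcal O}(x,y)=\sum_{i=1}^k\mathbf 1_{O_i}(x)\mathbf 1_{O_i}(y)\pi(y)/\pi(O_i)$. For an operator $A$ on $\ell^2(\pi)$, $\|A\|_{F,\pi}^2=\operatorname{Tr}(A^*A)=\sum_{x,y}\frac{\pi(x)}{\pi(y)}A(x,y)^2$. The convention $0^0=1$ is used when $\gamma=0$. *)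

theory Defs
  imports "HOL-Analysis.Analysis" "HOL-Library.Disjoint_Sets"
begin

text \<open>
  The finite state space is the universe of a type \<open>'a::finite\<close>. Functions on it are vectors
  \<open>real ^ 'a\<close>, kernels are matrices \<open>real ^ 'a ^ 'a\<close> with \<open>P(x,y) = P $ x $ y\<close>; thus \<open>P *v f\<close> is the
  action of a kernel on functions and \<open>**\<close> is composition of kernels.
\<close>

text \<open>The operator \<open>^\<close> on \<open>real ^ 'a ^ 'a\<close> would be the componentwise power, hence:\<close>

definition mpow :: "real ^ 'a ^ 'a \<Rightarrow> nat \<Rightarrow> real ^ 'a ^ 'a" where
  "mpow P t = (((**) P) ^^ t) (mat 1)"

definition pos_distribution :: "real ^ 'a \<Rightarrow> bool" where
  "pos_distribution \<pi> \<longleftrightarrow> (\<forall>x. \<pi> $ x > 0) \<and> (\<Sum>x\<in>UNIV. \<pi> $ x) = 1"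

definition markov_kernel :: "real ^ 'a ^ 'a \<Rightarrow> bool" where
  "markov_kernel P \<longleftrightarrow> (\<forall>x y. P $ x $ y \<ge> 0) \<and> (\<forall>x. (\<Sum>y\<in>UNIV. P $ x $ y) = 1)"

definition irreducible_kernel :: "real ^ 'a ^ 'a \<Rightarrow> bool" where
  "irreducible_kernel P \<longleftrightarrow> (\<forall>x y. \<exists>t. mpow P t $ x $ y > 0)"

definition aperiodic_kernel :: "real ^ 'a ^ 'a \<Rightarrow> bool" where
  "aperiodic_kernel P \<longleftrightarrow> (\<forall>x. Gcd {t::nat. t \<ge> 1 \<and> mpow P t $ x $ x > 0} = 1)"

definition ergodic_kernel :: "real ^ 'a ^ 'a \<Rightarrow> bool" where
  "ergodic_kernel P \<longleftrightarrow> irreducible_kernel P \<and> aperiodic_kernel P"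

definition reversible_kernel :: "real ^ 'a \<Rightarrow> real ^ 'a ^ 'a \<Rightarrow> bool" where
  "reversible_kernel \<pi> P \<longleftrightarrow> (\<forall>x y. \<pi> $ x * P $ x $ y = \<pi> $ y * P $ y $ x)"

definition inner_w :: "real ^ 'a \<Rightarrow> real ^ 'a \<Rightarrow> real ^ 'a \<Rightarrow> real" where
  "inner_w \<pi> f g = (\<Sum>x\<in>UNIV. \<pi> $ x * f $ x * g $ x)"

definition norm_w :: "real ^ 'a \<Rightarrow> real ^ 'a \<Rightarrow> real" where
  "norm_w \<pi> f = sqrt (inner_w \<pi> f f)"

definition l2_0 :: "real ^ 'a \<Rightarrow> (real ^ 'a) set" where
  "l2_0 \<pi> = {f. (\<Sum>x\<in>UNIV. \<pi> $ x * f $ x) = 0}"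

text \<open>
  \<open>\<eta> 1, \<dots>, \<eta> (n - 1)\<close> lists the eigenvalues of \<open>A\<close> on \<open>l2_0 \<pi>\<close> in nondecreasing order, each as often
  as the dimension of its eigenspace. (For \<open>\<pi>\<close>-self-adjoint \<open>A\<close> this is also the algebraic multiplicity.)
\<close>

definition ordered_eigenvalues ::
    "real ^ 'a \<Rightarrow> real ^ 'a ^ 'a \<Rightarrow> (nat \<Rightarrow> real) \<Rightarrow> bool" where
  "ordered_eigenvalues \<pi> A \<eta> \<longleftrightarrow>
     mono_on {1..CARD('a) - 1} \<eta> \<and>
     (\<forall>c. card {j \<in> {1..CARD('a) - 1}. \<eta> j = c} = dim {f \<in> l2_0 \<pi>. A *v f = c *\<^sub>R f})"

definition orthonormal_basis_l2_0 :: "real ^ 'a \<Rightarrow> (nat \<Rightarrow> real ^ 'a) \<Rightarrow> bool" where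
  "orthonormal_basis_l2_0 \<pi> \<phi> \<longleftrightarrow>
     (\<forall>i\<in>{1..CARD('a) - 1}. \<forall>j\<in>{1..CARD('a) - 1}.
        inner_w \<pi> (\<phi> i) (\<phi> j) = (if i = j then 1 else 0)) \<and>
     span (\<phi> ` {1..CARD('a) - 1}) = l2_0 \<pi>"

definition eigenbasis ::
    "real ^ 'a \<Rightarrow> real ^ 'a ^ 'a \<Rightarrow> (nat \<Rightarrow> real) \<Rightarrow> (nat \<Rightarrow> real ^ 'a) \<Rightarrow> bool" where
  "eigenbasis \<pi> P \<eta> \<phi> \<longleftrightarrow>
     orthonormal_basis_l2_0 \<pi> \<phi> \<and>
     (\<forall>j\<in>{1..CARD('a) - 1}. mpow P 2 *v \<phi> j = \<eta> j *\<^sub>R \<phi> j) \<and>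
     (\<forall>j\<in>{1..CARD('a) - 1}. \<exists>c. P *v \<phi> j = c *\<^sub>R \<phi> j)"

definition stationary_kernel :: "real ^ 'a \<Rightarrow> real ^ 'a ^ 'a" where
  "stationary_kernel \<pi> = (\<chi> x y. \<pi> $ y)"

definition gibbs_kernel :: "real ^ 'a \<Rightarrow> 'a set set \<Rightarrow> real ^ 'a ^ 'a" where
  "gibbs_kernel \<pi> \<O> =
     (\<chi> x y. \<Sum>B\<in>\<O>. indicator B x * indicator B y * \<pi> $ y / (\<Sum>z\<in>B. \<pi> $ z))"

definition frob_norm_sq :: "real ^ 'a \<Rightarrow> real ^ 'a ^ 'a \<Rightarrow> real" where
  "frob_norm_sq \<pi> A = (\<Sum>x\<in>UNIV. \<Sum>y\<in>UNIV. \<pi> $ x / \<pi> $ y * (A $ x $ y)\<^sup>2)"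

lemma frob_norm_sq_trace:
  assumes "pos_distribution \<pi>"
    and adj: "\<And>f g. inner_w \<pi> (B *v f) g = inner_w \<pi> f (A *v g)"
  shows "frob_norm_sq \<pi> A = trace (B ** A)"
proof -
  have pos: "\<pi> $ x > 0" for x
    using assms(1) by (simp add: pos_distribution_def)
  have "\<pi> $ x * B $ x $ y = \<pi> $ y * A $ y $ x" for x y
    using adj[of "axis y 1" "axis x 1"]
    by (simp add: inner_w_def matrix_vector_mult_basis column_def)
       (simp add: axis_def matrix_vector_mult_def if_distrib if_distribR cong: if_cong)
  then have B: "B $ x $ y = \<pi> $ y * A $ y $ x / \<pi> $ x" for x y
    using pos[of x] by (simp add: field_simps)
  have "trace (B ** A) = (\<Sum>x\<in>UNIV. \<Sum>y\<in>UNIV. \<pi> $ y / \<pi> $ x * (A $ y $ x)\<^sup>2)"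
    by (simp add: trace_def matrix_matrix_mult_def B power2_eq_square mult.assoc)
  also have "\<dots> = frob_norm_sq \<pi> A"
    unfolding frob_norm_sq_def by (rule sum.swap)
  finally show ?thesis by (rule sym)
qed

definition objective_finite ::
    "real ^ 'a \<Rightarrow> real ^ 'a ^ 'a \<Rightarrow> nat \<Rightarrow> (nat \<Rightarrow> real) \<Rightarrow> 'a set set \<Rightarrow> real" where
  "objective_finite \<pi> P T w \<O> =
     (\<Sum>t=1..T. w t * frob_norm_sq \<pi> (gibbs_kernel \<pi> \<O> ** mpow P t - stationary_kernel \<pi>))"

text \<open>Here \<open>t\<close> runs from \<open>0\<close>, so \<open>Suc t\<close> is the number of steps and \<open>\<gamma> ^ 0 = 1\<close> also for \<open>\<gamma> = 0\<close>.\<close>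

definition objective_discounted ::
    "real ^ 'a \<Rightarrow> real ^ 'a ^ 'a \<Rightarrow> real \<Rightarrow> 'a set set \<Rightarrow> real" where
  "objective_discounted \<pi> P \<gamma> \<O> =
     (\<Sum>t. \<gamma> ^ t *
        frob_norm_sq \<pi> (gibbs_kernel \<pi> \<O> ** mpow P (Suc t) - stationary_kernel \<pi>))"

lemma mpow_bounds:
  assumes "markov_kernel P"
  shows "0 \<le> mpow P t $ x $ y \<and> mpow P t $ x $ y \<le> 1"
proof (induction t arbitrary: x)
  case 0
  then show ?case by (simp add: mpow_def mat_def)
next
  case (Suc t)
  have P: "P $ x $ z \<ge> 0" "(\<Sum>z\<in>UNIV. P $ x $ z) = 1" for z
    using assms by (auto simp: markov_kernel_def)
  have eq: "mpow P (Suc t) $ x $ y = (\<Sum>z\<in>UNIV. P $ x $ z * mpow P t $ z $ y)"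
    by (simp add: mpow_def matrix_matrix_mult_def)
  have "(\<Sum>z\<in>UNIV. P $ x $ z * mpow P t $ z $ y) \<le> (\<Sum>z\<in>UNIV. P $ x $ z * 1)"
    by (intro sum_mono mult_left_mono) (use Suc P in auto)
  moreover have "0 \<le> (\<Sum>z\<in>UNIV. P $ x $ z * mpow P t $ z $ y)"
    by (intro sum_nonneg mult_nonneg_nonneg) (use Suc P in auto)
  ultimately show ?case using P by (simp add: eq)
qed

text \<open>The series defining \<^const>\<open>objective_discounted\<close> converges, so \<^const>\<open>suminf\<close> is its true sum.\<close>

lemma summable_objective_discounted:
  assumes "markov_kernel P" "pos_distribution \<pi>" "0 \<le> \<gamma>" "\<gamma> < 1"
  shows "summable (\<lambda>t. \<gamma> ^ t *
           frob_norm_sq \<pi> (gibbs_kernel \<pi> \<O> ** mpow P (Suc t) - stationary_kernel \<pi>))"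
proof -
  let ?G = "gibbs_kernel \<pi> \<O>"
  let ?D = "\<lambda>t. ?G ** mpow P (Suc t) - stationary_kernel \<pi>"
  define b where "b x y = (\<Sum>z\<in>UNIV. \<bar>?G $ x $ z\<bar>) + \<bar>\<pi> $ y\<bar>" for x y
  define K where "K = (\<Sum>x\<in>UNIV. \<Sum>y\<in>UNIV. \<pi> $ x / \<pi> $ y * (b x y)\<^sup>2)"
  have pos: "\<pi> $ x > 0" for x
    using assms(2) by (simp add: pos_distribution_def)
  have entry: "\<bar>?D t $ x $ y\<bar> \<le> b x y" for t x y
  proof -
    have "\<bar>(?G ** mpow P (Suc t)) $ x $ y\<bar> \<le> (\<Sum>z\<in>UNIV. \<bar>?G $ x $ z * mpow P (Suc t) $ z $ y\<bar>)"
      by (simp add: matrix_matrix_mult_def)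
    also have "\<dots> \<le> (\<Sum>z\<in>UNIV. \<bar>?G $ x $ z\<bar>)"
      using mpow_bounds[OF assms(1)]
      by (intro sum_mono) (simp add: abs_mult mult_left_le)
    finally show ?thesis
      by (simp add: b_def stationary_kernel_def)
  qed
  have le: "frob_norm_sq \<pi> (?D t) \<le> K" for t
    unfolding frob_norm_sq_def K_def
  proof (intro sum_mono mult_left_mono)
    fix x y
    show "(?D t $ x $ y)\<^sup>2 \<le> (b x y)\<^sup>2"
      using power_mono[OF entry[of t x y] abs_ge_zero, of 2] by simp
    show "0 \<le> \<pi> $ x / \<pi> $ y"
      using pos[of x] pos[of y] by simp
  qed
  have ge: "0 \<le> frob_norm_sq \<pi> (?D t)" for t
    unfolding frob_norm_sq_def using pos by (intro sum_nonneg mult_nonneg_nonneg) (auto simp: less_imp_le)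
  have "summable (\<lambda>t. \<gamma> ^ t * K)"
    using assms by (intro summable_mult2 summable_geometric) simp
  then show ?thesis
    by (rule summable_comparison_test'[where N = 0])
       (use le ge assms in \<open>auto simp: abs_mult intro!: mult_left_mono\<close>)
qed

definition dispersion :: "real ^ 'a \<Rightarrow> (nat \<Rightarrow> real ^ 'a) \<Rightarrow> nat \<Rightarrow> 'a set set \<Rightarrow> real" where
  "dispersion \<pi> \<phi> k \<O> =
     (\<Sum>j=1..k - 1. (norm_w \<pi> ((mat 1 - gibbs_kernel \<pi> \<O>) *v \<phi> j))\<^sup>2)"

end

theory Submission
  imports Defs
begin

text \<open>
  Since \<open>G = gibbs_kernel \<pi> \<O>\<close> is the \<open>\<pi>\<close>-orthogonal projection onto the block functions, the numbers
  \<open>a j = \<parallel>G \<phi>\<^sub>j\<parallel>\<^sup>2\<close> lie in \<open>[0, 1]\<close> and, the constants being block functions, add up to \<open>k - 1\<close>. Expanding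
  Frobenius norms in the eigenbasis turns the objective into \<open>\<Sum>j. \<beta> j * a j\<close>, and \<open>\<beta>\<close> is monotone
  because \<open>0 \<le> \<eta> \<le> 1\<close>. As \<open>\<delta> = (\<Sum>j<k. 1 - a j) = (\<Sum>j\<ge>k. a j)\<close> is the mass moved from the first
  \<open>k - 1\<close> indices to the others, moving it changes the objective by at least \<open>g * \<delta>\<close> and at most
  \<open>W * \<delta>\<close>.
\<close>

section \<open>The weighted inner product and the Frobenius norm\<close>

lemma inner_w_commute: "inner_w \<pi> f g = inner_w \<pi> g f"
  by (simp add: inner_w_def mult.commute mult.left_commute)

lemma linear_inner_w: "linear (\<lambda>f. inner_w \<pi> f g)"
  by (rule linearI) (simp_all add: inner_w_def algebra_simps sum.distrib sum_distrib_left)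

lemma inner_w_scaleR [simp]:
  "inner_w \<pi> (c *\<^sub>R f) g = c * inner_w \<pi> f g" "inner_w \<pi> f (c *\<^sub>R g) = c * inner_w \<pi> f g"
  by (simp_all add: inner_w_def sum_distrib_left mult_ac)

lemma inner_w_diff_left: "inner_w \<pi> (f - f') g = inner_w \<pi> f g - inner_w \<pi> f' g"
  by (rule linear_diff[OF linear_inner_w])

lemma inner_w_self_nonneg: "pos_distribution \<pi> \<Longrightarrow> inner_w \<pi> f f \<ge> 0"
  unfolding inner_w_def mult.assoc power2_eq_square[symmetric]
  by (intro sum_nonneg mult_nonneg_nonneg) (auto simp: pos_distribution_def less_imp_le)

lemma norm_w_sq: "pos_distribution \<pi> \<Longrightarrow> (norm_w \<pi> f)\<^sup>2 = inner_w \<pi> f f"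
  by (simp add: norm_w_def inner_w_self_nonneg)

text \<open>Both sides are linear in \<open>f\<close>, and by orthonormality they agree on each
  basis vector, hence on the span.\<close>

lemma orthonormal_expansion:
  assumes "finite J"
    and on: "\<And>i j. i \<in> J \<Longrightarrow> j \<in> J \<Longrightarrow> inner_w \<pi> (\<psi> i) (\<psi> j) = (if i = j then 1 else 0)"
    and "f \<in> span (\<psi> ` J)"
  shows "(\<Sum>j\<in>J. inner_w \<pi> f (\<psi> j) *\<^sub>R \<psi> j) = f"
proof -
  have lin: "linear (\<lambda>f. \<Sum>j\<in>J. inner_w \<pi> f (\<psi> j) *\<^sub>R \<psi> j)"
    by (rule linearI)
       (simp_all add: linear_add[OF linear_inner_w] scaleR_add_left sum.distrib scaleR_sum_right)
  have "(\<Sum>j\<in>J. inner_w \<pi> b (\<psi> j) *\<^sub>R \<psi> j) = id b" if "b \<in> \<psi> ` J" for b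
  proof -
    from that obtain i where i: "i \<in> J" "b = \<psi> i" by blast
    have "(\<Sum>j\<in>J. inner_w \<pi> b (\<psi> j) *\<^sub>R \<psi> j) = (\<Sum>j\<in>J. if i = j then \<psi> j else 0)"
      using i by (intro sum.cong) (auto simp: on)
    with i \<open>finite J\<close> show ?thesis by simp
  qed
  from linear_eq_on[OF lin linear_id \<open>f \<in> span (\<psi> ` J)\<close> this] show ?thesis by simp
qed

text \<open>The trace of \<open>A* A\<close> is the same in every \<pi>-orthonormal basis. In
  coordinates, completeness of the basis collapses the double sum over \<open>y\<close> and
  \<open>z\<close> to its diagonal and produces the factor \<open>1 / \<pi> $ y\<close>.\<close>

lemma frob_norm_sq_orthonormal:
  assumes pos: "pos_distribution \<pi>" and fin: "finite J"
    and on: "\<And>i j. i \<in> J \<Longrightarrow> j \<in> J \<Longrightarrow> inner_w \<pi> (\<psi> i) (\<psi> j) = (if i = j then 1 else 0)"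
    and span: "span (\<psi> ` J) = UNIV"
  shows "frob_norm_sq \<pi> A = (\<Sum>j\<in>J. (norm_w \<pi> (A *v \<psi> j))\<^sup>2)"
proof -
  have nz: "\<pi> $ x \<noteq> 0" for x
    using pos by (auto simp: pos_distribution_def less_le)
  \<comment> \<open>Coordinate \<open>z\<close> of the expansion of \<open>axis y 1\<close>, whose
    coefficients are \<open>\<pi> $ y * \<psi> j $ y\<close>.\<close>
  have ps: "\<pi> $ y * (\<Sum>j\<in>J. \<psi> j $ y * \<psi> j $ z) = (if y = z then 1 else 0)" for y z
  proof -
    have "inner_w \<pi> (axis y 1) h = \<pi> $ y * h $ y" for h
      by (simp add: inner_w_def axis_def if_distrib if_distribR cong: if_cong)
    then have "(\<Sum>j\<in>J. (\<pi> $ y * \<psi> j $ y) *\<^sub>R \<psi> j) = axis y 1"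
      using orthonormal_expansion[OF fin on, of "axis y 1"] span by simp
    then have "(\<Sum>j\<in>J. (\<pi> $ y * \<psi> j $ y) *\<^sub>R \<psi> j) $ z = axis y 1 $ z"
      by simp
    then show ?thesis
      by (simp add: axis_def sum_distrib_left mult.assoc eq_commute)
  qed
  have complete: "(\<Sum>j\<in>J. \<psi> j $ y * \<psi> j $ z) = (if y = z then 1 / \<pi> $ y else 0)" for y z
    using nonzero_mult_div_cancel_left[OF nz[of y], of "\<Sum>j\<in>J. \<psi> j $ y * \<psi> j $ z"]
    unfolding ps by (cases "y = z") simp_all
  have sq: "\<pi> $ x * (A *v h) $ x * (A *v h) $ x =
      (\<Sum>y\<in>UNIV. \<Sum>z\<in>UNIV. \<pi> $ x * (A $ x $ y * A $ x $ z) * (h $ y * h $ z))" for x h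
    unfolding matrix_vector_mult_def vec_lambda_beta mult.assoc sum_product
    by (simp add: sum_distrib_left mult_ac)
  have "(\<Sum>j\<in>J. (norm_w \<pi> (A *v \<psi> j))\<^sup>2) =
      (\<Sum>j\<in>J. \<Sum>x\<in>UNIV. \<Sum>y\<in>UNIV. \<Sum>z\<in>UNIV. \<pi> $ x * (A $ x $ y * A $ x $ z) * (\<psi> j $ y * \<psi> j $ z))"
    by (simp only: norm_w_sq[OF pos] inner_w_def sq)
  also have "\<dots> = (\<Sum>x\<in>UNIV. \<Sum>y\<in>UNIV. \<Sum>z\<in>UNIV. \<Sum>j\<in>J. \<pi> $ x * (A $ x $ y * A $ x $ z) * (\<psi> j $ y * \<psi> j $ z))"
    by (subst sum.swap, rule sum.cong[OF refl], subst sum.swap, rule sum.cong[OF refl],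
        rule sum.swap)
  also have "\<dots> = (\<Sum>x\<in>UNIV. \<Sum>y\<in>UNIV. \<Sum>z\<in>UNIV.
      \<pi> $ x * (A $ x $ y * A $ x $ z) * (if y = z then 1 / \<pi> $ y else 0))"
    by (simp only: sum_distrib_left[symmetric] complete)
  also have "\<dots> = frob_norm_sq \<pi> A"
    by (simp add: frob_norm_sq_def if_distrib power2_eq_square cong: if_cong)
  finally show ?thesis by simp
qed

lemma norm_w_sq_scaleR:
  "pos_distribution \<pi> \<Longrightarrow> (norm_w \<pi> (c *\<^sub>R f))\<^sup>2 = c\<^sup>2 * (norm_w \<pi> f)\<^sup>2"
  by (simp add: norm_w_sq power2_eq_square[of c])

section \<open>Powers and eigenvalues of a Markov kernel\<close>

lemma mpow_Suc: "mpow P (Suc t) = P ** mpow P t"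
  by (simp add: mpow_def)

lemma mpow_eigenvector:
  assumes "P *v f = c *\<^sub>R f"
  shows "mpow P t *v f = c ^ t *\<^sub>R f"
proof (induction t)
  case 0
  then show ?case by (simp add: mpow_def)
next
  case (Suc t)
  then show ?case
    using assms
    by (simp add: mpow_Suc matrix_vector_mul_assoc[symmetric] matrix_vector_mult_scaleR mult.commute)
qed

lemma markov_kernel_one: "markov_kernel P \<Longrightarrow> P *v 1 = 1"
  by (simp add: markov_kernel_def matrix_vector_mult_def vec_eq_iff)

text \<open>Maximum principle: at a point \<open>x\<close> where the modulus of \<open>f\<close> is
  largest, \<open>P *v f\<close> is an average of values of modulus at most
  \<open>\<bar>f $ x\<bar>\<close>.\<close>

lemma markov_kernel_eigenvalue_bound:
  fixes P :: "real ^ 'a ^ 'a"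
  assumes "markov_kernel P" "P *v f = c *\<^sub>R f" "f \<noteq> 0"
  shows "\<bar>c\<bar> \<le> 1"
proof -
  have "Max (range (\<lambda>y. \<bar>f $ y\<bar>)) \<in> range (\<lambda>y. \<bar>f $ y\<bar>)"
    by (rule Max_in) auto
  then obtain x where "Max (range (\<lambda>y. \<bar>f $ y\<bar>)) = \<bar>f $ x\<bar>"
    by (rule rangeE)
  then have x: "\<bar>f $ y\<bar> \<le> \<bar>f $ x\<bar>" for y
    using Max_ge[of "range (\<lambda>y. \<bar>f $ y\<bar>)" "\<bar>f $ y\<bar>"] by simp
  from \<open>f \<noteq> 0\<close> obtain y where "f $ y \<noteq> 0"
    by (auto simp: vec_eq_iff)
  with x[of y] have fx: "\<bar>f $ x\<bar> > 0" by linarith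
  have "\<bar>c\<bar> * \<bar>f $ x\<bar> = \<bar>(P *v f) $ x\<bar>"
    using assms by (simp add: abs_mult)
  also have "\<dots> \<le> (\<Sum>y\<in>UNIV. \<bar>P $ x $ y * f $ y\<bar>)"
    by (simp add: matrix_vector_mult_def)
  also have "\<dots> \<le> (\<Sum>y\<in>UNIV. P $ x $ y * \<bar>f $ x\<bar>)"
    using assms(1) x by (intro sum_mono) (auto simp: abs_mult markov_kernel_def intro: mult_left_mono)
  also have "\<dots> = 1 * \<bar>f $ x\<bar>"
    using assms(1) by (simp add: sum_distrib_right[symmetric] markov_kernel_def)
  finally show ?thesis
    using fx by (simp only: mult_le_cancel_right)
qed

section \<open>The Gibbs kernel of a partition as a projection\<close>

lemma gibbs_kernel_reversible: "reversible_kernel \<pi> (gibbs_kernel \<pi> \<O>)"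
  by (simp add: reversible_kernel_def gibbs_kernel_def sum_distrib_left mult_ac)

text \<open>Blocks are disjoint, so only the block of \<open>x\<close> contributes: the row at
  \<open>x\<close> is \<pi> conditioned on that block.\<close>

lemma gibbs_kernel_block:
  assumes part: "partition_on UNIV \<O>" and "B \<in> \<O>" "x \<in> B"
  shows "gibbs_kernel \<pi> \<O> $ x $ y = indicator B y * \<pi> $ y / (\<Sum>z\<in>B. \<pi> $ z)"
proof -
  have "finite \<O>" by simp
  have "x \<notin> C" if "C \<in> \<O> - {B}" for C
    using partition_onD2[OF part] that assms by (auto dest: disjointD)
  then have "(\<Sum>C\<in>\<O> - {B}. indicator C x * indicator C y * \<pi> $ y / (\<Sum>z\<in>C. \<pi> $ z)) = 0"
    by (intro sum.neutral) auto
  then show ?thesis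
    using assms by (simp add: gibbs_kernel_def sum.remove[OF \<open>finite \<O>\<close> \<open>B \<in> \<O>\<close>])
qed

lemma partition_on_sum:
  fixes h :: "'a::finite \<Rightarrow> real"
  assumes "partition_on UNIV \<O>"
  shows "(\<Sum>x\<in>UNIV. h x) = (\<Sum>B\<in>\<O>. \<Sum>x\<in>B. h x)"
  using sum.Union_disjoint[of \<O> h] assms
  by (auto simp: partition_on_def disjoint_def)

context
  fixes \<pi> :: "real ^ 'a" and \<O> :: "'a set set"
  assumes pos: "pos_distribution \<pi>" and part: "partition_on UNIV \<O>"
begin

lemma block_mass_pos:
  assumes "B \<in> \<O>"
  shows "(\<Sum>z\<in>B. \<pi> $ z) > 0"
  using assms part pos
  by (intro sum_pos) (auto simp: partition_on_def pos_distribution_def)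

lemma block_obtain: obtains B where "B \<in> \<O>" "x \<in> B"
  using partition_onD1[OF part] by blast

lemma gibbs_kernel_row_sum: "(\<Sum>y\<in>UNIV. gibbs_kernel \<pi> \<O> $ x $ y) = 1"
proof -
  obtain B where B: "B \<in> \<O>" "x \<in> B" by (rule block_obtain)
  show ?thesis
    using block_mass_pos[OF B(1)]
    by (simp add: gibbs_kernel_block[OF part B] sum_divide_distrib[symmetric] sum.If_cases
        indicator_def if_distrib if_distribR cong: if_cong)
qed

lemma gibbs_kernel_idempotent: "gibbs_kernel \<pi> \<O> ** gibbs_kernel \<pi> \<O> = gibbs_kernel \<pi> \<O>"
proof -
  have "(\<Sum>y\<in>UNIV. gibbs_kernel \<pi> \<O> $ x $ y * gibbs_kernel \<pi> \<O> $ y $ z) = gibbs_kernel \<pi> \<O> $ x $ z"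
    for x z
  proof -
    obtain B where B: "B \<in> \<O>" "x \<in> B" by (rule block_obtain)
    \<comment> \<open>For \<open>y\<close> in \<open>B\<close> the rows at \<open>x\<close> and
      \<open>y\<close> coincide; for \<open>y\<close> outside \<open>B\<close> the first factor
      vanishes. The second factor then no longer depends on \<open>y\<close>, and the row sum 1
      remains.\<close>
    have "gibbs_kernel \<pi> \<O> $ x $ y * gibbs_kernel \<pi> \<O> $ y $ z =
        gibbs_kernel \<pi> \<O> $ x $ y * gibbs_kernel \<pi> \<O> $ x $ z" for y
      using gibbs_kernel_block[OF part B] gibbs_kernel_block[OF part B(1), of y]
      by (cases "y \<in> B") auto
    then show ?thesis
      by (simp only: sum_distrib_right[symmetric] gibbs_kernel_row_sum mult_1_left)
  qed
  then show ?thesis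
    by (simp add: matrix_matrix_mult_def vec_eq_iff)
qed

text \<open>For an orthogonal projection this is its rank, here the dimension of the space of block
  functions. Concretely, the row at \<open>x\<close> in \<open>B\<close> contributes
  \<open>\<pi> $ x\<close> divided by the mass of \<open>B\<close>, so each block contributes
  1.\<close>

lemma frob_norm_sq_gibbs_kernel: "frob_norm_sq \<pi> (gibbs_kernel \<pi> \<O>) = card \<O>"
proof -
  let ?m = "\<lambda>B. \<Sum>z\<in>B. \<pi> $ z"
  have p: "\<pi> $ x > 0" for x
    using pos by (simp add: pos_distribution_def)
  have "(\<Sum>y\<in>UNIV. \<pi> $ x / \<pi> $ y * (gibbs_kernel \<pi> \<O> $ x $ y)\<^sup>2) = \<pi> $ x / ?m B"
    if B: "B \<in> \<O>" "x \<in> B" for x B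
  proof -
    \<comment> \<open>One of the two factors \<open>\<pi> $ y\<close> in the square cancels; what is
      left is a constant times a row that sums to 1.\<close>
    have "\<pi> $ x / \<pi> $ y * (gibbs_kernel \<pi> \<O> $ x $ y)\<^sup>2 = \<pi> $ x / ?m B * gibbs_kernel \<pi> \<O> $ x $ y" for y
      using p[of y] unfolding gibbs_kernel_block[OF part B]
      by (cases "y \<in> B") (simp_all add: field_simps power2_eq_square)
    then show ?thesis
      by (simp only: sum_distrib_left[symmetric] gibbs_kernel_row_sum mult_1_right)
  qed
  then have "frob_norm_sq \<pi> (gibbs_kernel \<pi> \<O>) = (\<Sum>B\<in>\<O>. \<Sum>x\<in>B. \<pi> $ x / ?m B)"
    unfolding frob_norm_sq_def by (subst partition_on_sum[OF part]) (intro sum.cong refl)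
  also have "\<dots> = (\<Sum>B\<in>\<O>. 1)"
    using block_mass_pos by (intro sum.cong) (auto simp: sum_divide_distrib[symmetric] less_imp_neq[symmetric])
  finally show ?thesis by simp
qed

end

section \<open>Self-adjoint kernels and the Pythagorean identity\<close>

lemma reversible_kernel_adjoint:
  assumes "reversible_kernel \<pi> P"
  shows "inner_w \<pi> (P *v f) g = inner_w \<pi> f (P *v g)"
proof -
  have "inner_w \<pi> (P *v f) g = (\<Sum>x\<in>UNIV. \<Sum>y\<in>UNIV. (\<pi> $ x * P $ x $ y) * f $ y * g $ x)"
    by (simp add: inner_w_def matrix_vector_mult_def sum_distrib_left sum_distrib_right mult_ac)
  also have "\<dots> = (\<Sum>y\<in>UNIV. \<Sum>x\<in>UNIV. (\<pi> $ y * P $ y $ x) * f $ y * g $ x)"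
    using assms by (subst sum.swap) (simp add: reversible_kernel_def)
  also have "\<dots> = inner_w \<pi> f (P *v g)"
    by (simp add: inner_w_def matrix_vector_mult_def sum_distrib_left sum_distrib_right mult_ac)
  finally show ?thesis .
qed

text \<open>Self-adjointness and idempotence make \<open>G *v f\<close> orthogonal to
  \<open>f - G *v f\<close>, so this is Pythagoras.\<close>

lemma norm_w_projection_complement:
  assumes pos: "pos_distribution \<pi>" and rev: "reversible_kernel \<pi> G" and idem: "G ** G = G"
  shows "(norm_w \<pi> ((mat 1 - G) *v f))\<^sup>2 = (norm_w \<pi> f)\<^sup>2 - (norm_w \<pi> (G *v f))\<^sup>2"
proof -
  have "inner_w \<pi> (G *v f) (G *v f) = inner_w \<pi> f (G *v f)"
    using reversible_kernel_adjoint[OF rev, of f "G *v f"]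
    by (simp add: matrix_vector_mul_assoc idem)
  then show ?thesis
    by (simp add: norm_w_sq[OF pos] matrix_vector_mult_diff_rdistrib inner_w_diff_left
        inner_w_commute[of \<pi> _ "f - G *v f"] inner_w_commute[of \<pi> "G *v f" f])
qed

section \<open>Moving mass under monotone weights\<close>

lemma weighted_sum_bounds:
  fixes a \<beta> :: "nat \<Rightarrow> real"
  assumes k: "k \<in> {2..m}" and mono: "mono_on {1..m} \<beta>"
    and a: "\<And>j. j \<in> {1..m} \<Longrightarrow> 0 \<le> a j \<and> a j \<le> 1"
    and total: "(\<Sum>j=1..m. a j) = real (k - 1)"
    and \<delta>: "\<delta> = (\<Sum>j=1..k - 1. 1 - a j)"
  shows "(\<Sum>j=1..k - 1. \<beta> j) + (\<beta> k - \<beta> (k - 1)) * \<delta> \<le> (\<Sum>j=1..m. \<beta> j * a j)"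
    and "(\<Sum>j=1..m. \<beta> j * a j) \<le> (\<Sum>j=1..k - 1. \<beta> j) + (\<beta> m - \<beta> 1) * \<delta>"
proof -
  have split: "(\<Sum>j=1..m. f j) = (\<Sum>j=1..k - 1. f j) + (\<Sum>j=k..m. f j)" for f :: "nat \<Rightarrow> real"
    using sum.ub_add_nat[of 1 "k - 1" f "m - (k - 1)"] k by simp
  have \<delta>': "\<delta> = (\<Sum>j=k..m. a j)"
    \<comment> \<open>The first \<open>k - 1\<close> numbers fall short of the total
      \<open>k - 1\<close> by \<delta>, so the remaining ones carry exactly that mass.\<close>
    using total split[of a] by (simp add: \<delta> sum_subtractf)
  \<comment> \<open>Relative to full mass on the first \<open>k - 1\<close> indices: what is gained
    from index \<open>k\<close> on, minus what is lost before it. Each has mass \<delta>. The gain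
    is weighted between \<open>\<beta> k\<close> and \<open>\<beta> m\<close>, the loss between
    \<open>\<beta> 1\<close> and \<open>\<beta> (k - 1)\<close>; pairing opposite extremes gives the
    two bounds.\<close>
  have eq: "(\<Sum>j=1..m. \<beta> j * a j) =
      (\<Sum>j=1..k - 1. \<beta> j) + (\<Sum>j=k..m. \<beta> j * a j) - (\<Sum>j=1..k - 1. \<beta> j * (1 - a j))"
    unfolding split[of "\<lambda>j. \<beta> j * a j"] by (simp add: algebra_simps sum_subtractf)
  have le: "\<beta> i \<le> \<beta> j" if "1 \<le> i" "i \<le> j" "j \<le> m" for i j
    using mono that by (auto simp: mono_on_def)
  have "\<beta> k * \<delta> \<le> (\<Sum>j=k..m. \<beta> j * a j)"
    unfolding \<delta>' sum_distrib_left using k a by (intro sum_mono mult_right_mono le) auto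
  moreover have "(\<Sum>j=k..m. \<beta> j * a j) \<le> \<beta> m * \<delta>"
    unfolding \<delta>' sum_distrib_left using k a by (intro sum_mono mult_right_mono le) auto
  moreover have "\<beta> 1 * \<delta> \<le> (\<Sum>j=1..k - 1. \<beta> j * (1 - a j))"
    unfolding \<delta> sum_distrib_left using k a by (intro sum_mono mult_right_mono le) auto
  moreover have "(\<Sum>j=1..k - 1. \<beta> j * (1 - a j)) \<le> \<beta> (k - 1) * \<delta>"
    unfolding \<delta> sum_distrib_left using k a by (intro sum_mono mult_right_mono le) auto
  ultimately show "(\<Sum>j=1..k - 1. \<beta> j) + (\<beta> k - \<beta> (k - 1)) * \<delta> \<le> (\<Sum>j=1..m. \<beta> j * a j)"
    and "(\<Sum>j=1..m. \<beta> j * a j) \<le> (\<Sum>j=1..k - 1. \<beta> j) + (\<beta> m - \<beta> 1) * \<delta>"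
    unfolding eq by (simp_all add: left_diff_distrib)
qed

theorem theorem6p2:
  fixes \<pi> :: "real ^ 'a" and P :: "real ^ 'a ^ 'a"
    and n k :: nat
    and \<eta> :: "nat \<Rightarrow> real" and \<phi> :: "nat \<Rightarrow> real ^ 'a"
    and F :: "'a set set \<Rightarrow> real" and \<beta> :: "nat \<Rightarrow> real"
    and L g W :: real
  assumes n: "n = CARD('a)" "n \<ge> 3"
    and \<pi>: "pos_distribution \<pi>"
    and P: "markov_kernel P" "ergodic_kernel P" "reversible_kernel \<pi> P"
    and k: "k \<in> {2..n - 1}"
    and \<eta>: "ordered_eigenvalues \<pi> (mpow P 2) \<eta>"
    and \<phi>: "eigenbasis \<pi> P \<eta> \<phi>"
    and F\<beta>:
      "(\<exists>T w. T \<ge> 1 \<and> (\<forall>t\<in>{1..T}. w t \<ge> 0) \<and> (\<exists>t\<in>{1..T}. w t \<noteq> 0) \<and>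
          F = objective_finite \<pi> P T w \<and>
          (\<forall>j\<in>{1..n - 1}. \<beta> j = (\<Sum>t=1..T. w t * \<eta> j ^ t))) \<or>
       (\<exists>\<gamma>. 0 \<le> \<gamma> \<and> \<gamma> < 1 \<and>
          F = objective_discounted \<pi> P \<gamma> \<and>
          (\<forall>j\<in>{1..n - 1}. \<beta> j = \<eta> j / (1 - \<gamma> * \<eta> j)))"
    and L: "L = (\<Sum>j=1..k - 1. \<beta> j)"
    and g: "g = \<beta> k - \<beta> (k - 1)"
    and W: "W = \<beta> (n - 1) - \<beta> 1"
  shows "\<forall>\<O>. partition_on UNIV \<O> \<and> card \<O> = k \<longrightarrow>
           L + g * dispersion \<pi> \<phi> k \<O> \<le> F \<O> \<and>
           F \<O> \<le> L + W * dispersion \<pi> \<phi> k \<O>"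
proof (intro allI impI)
  fix \<O> :: "'a set set"
  assume "partition_on UNIV \<O> \<and> card \<O> = k"
  then have part: "partition_on UNIV \<O>" and card: "card \<O> = k" by auto

  \<comment> \<open>An orthonormal basis of the whole space and the numbers
    \<open>a j\<close>\<close>
  define G where "G = gibbs_kernel \<pi> \<O>"
  define I where "I = {1..n - 1}"
  define a where "a j = (norm_w \<pi> (G *v \<phi> j))\<^sup>2" for j
  \<comment> \<open>The Frobenius formula needs a basis of all functions, so the constant function
    \<open>1\<close> is put at the free index 0.\<close>
  define \<psi> where "\<psi> j = (if j = 0 then 1 else \<phi> j)" for j
  have onb: "orthonormal_basis_l2_0 \<pi> \<phi>"
    using \<phi> by (simp add: eigenbasis_def)
  then have on: "inner_w \<pi> (\<phi> i) (\<phi> j) = (if i = j then 1 else 0)" if "i \<in> I" "j \<in> I" for i j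
    using that by (simp add: orthonormal_basis_l2_0_def I_def n)
  have span\<phi>: "span (\<phi> ` I) = l2_0 \<pi>"
    using onb by (simp add: orthonormal_basis_l2_0_def I_def n)
  have mean0: "(\<Sum>x\<in>UNIV. \<pi> $ x * \<phi> j $ x) = 0" if "j \<in> I" for j
    using span_base[of "\<phi> j" "\<phi> ` I"] that span\<phi> by (simp add: l2_0_def)
  have one_one: "inner_w \<pi> 1 1 = 1"
    using \<pi> by (simp add: inner_w_def pos_distribution_def)
  have on\<psi>: "inner_w \<pi> (\<psi> i) (\<psi> j) = (if i = j then 1 else 0)"
    if "i \<in> insert 0 I" "j \<in> insert 0 I" for i j
    using that on mean0 one_one
    by (auto simp: \<psi>_def I_def inner_w_def mult.assoc)
  have im\<psi>: "\<psi> ` insert 0 I = insert 1 (\<phi> ` I)"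
    by (auto simp: \<psi>_def I_def)
  have "f \<in> span (insert 1 (\<phi> ` I))" for f
  proof -
    \<comment> \<open>Subtracting its \<pi>-mean puts \<open>f\<close> into
      \<open>l2_0 \<pi>\<close>.\<close>
    have "f - (\<Sum>x\<in>UNIV. \<pi> $ x * f $ x) *\<^sub>R 1 \<in> span (\<phi> ` I)"
      using \<pi> by (simp add: span\<phi> l2_0_def algebra_simps sum_subtractf
          sum_distrib_left[symmetric] sum_distrib_right[symmetric] pos_distribution_def)
    then show ?thesis by (auto simp: span_insert)
  qed
  then have span\<psi>: "span (\<psi> ` insert 0 I) = UNIV"
    unfolding im\<psi> by blast
  have "0 \<notin> I" "finite I" by (auto simp: I_def)
  have frob: "frob_norm_sq \<pi> A = (norm_w \<pi> (A *v 1))\<^sup>2 + (\<Sum>j\<in>I. (norm_w \<pi> (A *v \<phi> j))\<^sup>2)" for A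
  proof -
    have "frob_norm_sq \<pi> A = (norm_w \<pi> (A *v \<psi> 0))\<^sup>2 + (\<Sum>j\<in>I. (norm_w \<pi> (A *v \<psi> j))\<^sup>2)"
      using frob_norm_sq_orthonormal[OF \<pi> _ on\<psi> span\<psi>] \<open>0 \<notin> I\<close> \<open>finite I\<close> by simp
    also have "(\<Sum>j\<in>I. (norm_w \<pi> (A *v \<psi> j))\<^sup>2) = (\<Sum>j\<in>I. (norm_w \<pi> (A *v \<phi> j))\<^sup>2)"
      by (intro sum.cong) (auto simp: \<psi>_def I_def)
    finally show ?thesis by (simp add: \<psi>_def)
  qed
  have G1: "G *v 1 = 1"
    using gibbs_kernel_row_sum[OF \<pi> part] by (simp add: G_def matrix_vector_mult_def vec_eq_iff)
  have complement: "(norm_w \<pi> ((mat 1 - G) *v \<phi> j))\<^sup>2 = 1 - a j" if "j \<in> I" for j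
    using norm_w_projection_complement[OF \<pi> gibbs_kernel_reversible
        gibbs_kernel_idempotent[OF \<pi> part], of "\<phi> j"] on[OF that that]
    by (simp add: a_def G_def norm_w_sq[OF \<pi>])
  have a01: "0 \<le> a j \<and> a j \<le> 1" if "j \<in> I" for j
    using complement[OF that] zero_le_power2[of "norm_w \<pi> ((mat 1 - G) *v \<phi> j)"]
    by (simp add: a_def)
  \<comment> \<open>The squared Frobenius norm of \<open>G\<close> is \<open>k\<close>; the constant
    function accounts for 1 of it because \<open>G *v 1 = 1\<close>.\<close>
  have total: "(\<Sum>j\<in>I. a j) = real (k - 1)"
    using frob[of G] frob_norm_sq_gibbs_kernel[OF \<pi> part] card k
    by (simp add: a_def G_def[symmetric] G1 norm_w_sq[OF \<pi>] one_one of_nat_diff)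
  have \<delta>: "dispersion \<pi> \<phi> k \<O> = (\<Sum>j=1..k - 1. 1 - a j)"
    unfolding dispersion_def G_def[symmetric]
    using k by (intro sum.cong complement) (auto simp: I_def)

  \<comment> \<open>Eigenvalues and the expansion of a single time step\<close>
  have "\<exists>c. P *v \<phi> j = c *\<^sub>R \<phi> j \<and> \<eta> j = c\<^sup>2 \<and> \<bar>c\<bar> \<le> 1" if "j \<in> I" for j
  proof -
    have "\<forall>j\<in>I. \<exists>c. P *v \<phi> j = c *\<^sub>R \<phi> j"
      using \<phi> by (simp add: eigenbasis_def I_def n)
    with that obtain c where c: "P *v \<phi> j = c *\<^sub>R \<phi> j" by blast
    \<comment> \<open>Applying \<open>P\<close> twice identifies \<open>\<eta> j\<close> as the
      square of an eigenvalue of \<open>P\<close>. This gives \<eta> its nonnegativity, and the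
      maximum principle bounds it by 1.\<close>
    have "\<eta> j *\<^sub>R \<phi> j = c\<^sup>2 *\<^sub>R \<phi> j"
      using \<phi> \<open>j \<in> I\<close> mpow_eigenvector[OF c, of 2] by (simp add: eigenbasis_def I_def n)
    moreover have "\<phi> j \<noteq> 0"
      using on[OF that that] by (auto simp: inner_w_def)
    ultimately show ?thesis
      using c markov_kernel_eigenvalue_bound[OF P(1) c] by auto
  qed
  then obtain c where c: "\<And>j. j \<in> I \<Longrightarrow> P *v \<phi> j = c j *\<^sub>R \<phi> j \<and> \<eta> j = (c j)\<^sup>2 \<and> \<bar>c j\<bar> \<le> 1"
    by metis
  have \<eta>01: "0 \<le> \<eta> j" "\<eta> j \<le> 1" if "j \<in> I" for j
    using c[OF that] by (auto simp: abs_square_le_1)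
  have mono\<eta>: "mono_on I \<eta>"
    using \<eta> by (simp add: ordered_eigenvalues_def I_def n)
  \<comment> \<open>On \<open>1\<close> both kernels act as the identity and cancel. On
    \<open>\<phi> j\<close> the stationary kernel vanishes, while \<open>mpow P t\<close> scales by
    \<open>c j ^ t\<close>, which becomes \<open>\<eta> j ^ t\<close> after squaring.\<close>
  have step: "frob_norm_sq \<pi> (G ** mpow P t - stationary_kernel \<pi>) = (\<Sum>j\<in>I. \<eta> j ^ t * a j)" for t
  proof -
    have "stationary_kernel \<pi> *v 1 = 1"
      using \<pi> by (simp add: stationary_kernel_def matrix_vector_mult_def vec_eq_iff pos_distribution_def)
    moreover have "mpow P t *v 1 = 1"
      using mpow_eigenvector[of P 1 1 t] markov_kernel_one[OF P(1)] by simp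
    ultimately have "(G ** mpow P t - stationary_kernel \<pi>) *v 1 = 0"
      by (simp add: matrix_vector_mult_diff_rdistrib matrix_vector_mul_assoc[symmetric] G1)
    moreover have "(norm_w \<pi> ((G ** mpow P t - stationary_kernel \<pi>) *v \<phi> j))\<^sup>2 = \<eta> j ^ t * a j"
      if "j \<in> I" for j
    proof -
      have "stationary_kernel \<pi> *v \<phi> j = 0"
        using mean0[OF that] by (simp add: stationary_kernel_def matrix_vector_mult_def vec_eq_iff)
      then have "(G ** mpow P t - stationary_kernel \<pi>) *v \<phi> j = c j ^ t *\<^sub>R (G *v \<phi> j)"
        using mpow_eigenvector[of P "\<phi> j" "c j" t] c[OF that]
        by (simp add: matrix_vector_mult_diff_rdistrib matrix_vector_mul_assoc[symmetric]
            matrix_vector_mult_scaleR)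
      then show ?thesis
        using c[OF that]
        by (simp add: norm_w_sq_scaleR[OF \<pi>] a_def power_mult[symmetric] mult.commute)
    qed
    ultimately show ?thesis
      by (simp add: frob norm_w_def inner_w_def)
  qed

  \<comment> \<open>The two objectives and the monotonicity of their weights\<close>
  have F: "F \<O> = (\<Sum>j\<in>I. \<beta> j * a j)" and mono\<beta>: "mono_on I \<beta>"
    using F\<beta>
  proof (atomize (full), elim disjE exE conjE)
    fix T :: nat and w :: "nat \<Rightarrow> real"
    assume w: "\<forall>t\<in>{1..T}. w t \<ge> 0" and F: "F = objective_finite \<pi> P T w"
      and \<beta>: "\<forall>j\<in>{1..n - 1}. \<beta> j = (\<Sum>t=1..T. w t * \<eta> j ^ t)"
    have "F \<O> = (\<Sum>t=1..T. \<Sum>j\<in>I. w t * \<eta> j ^ t * a j)"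
      by (simp add: F objective_finite_def G_def[symmetric] step sum_distrib_left mult.assoc)
    also have "\<dots> = (\<Sum>j\<in>I. \<beta> j * a j)"
      using \<beta> by (subst sum.swap) (simp add: sum_distrib_right I_def)
    finally have "F \<O> = (\<Sum>j\<in>I. \<beta> j * a j)" .
    moreover have "mono_on I \<beta>"
    proof (rule mono_onI)
      fix i j assume "i \<in> I" "j \<in> I" "i \<le> j"
      \<comment> \<open>Each power is monotone on the nonnegative reals, where \<eta> takes its
        values, and nonnegative \<open>w t\<close> preserve the order.\<close>
      with w \<eta>01 mono\<eta> have "(\<Sum>t=1..T. w t * \<eta> i ^ t) \<le> (\<Sum>t=1..T. w t * \<eta> j ^ t)"
        by (intro sum_mono mult_left_mono power_mono) (auto simp: mono_on_def)
      with \<beta> \<open>i \<in> I\<close> \<open>j \<in> I\<close> show "\<beta> i \<le> \<beta> j" by (simp add: I_def)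
    qed
    ultimately show "F \<O> = (\<Sum>j\<in>I. \<beta> j * a j) \<and> mono_on I \<beta>" ..
  next
    fix \<gamma> :: real
    assume \<gamma>: "0 \<le> \<gamma>" "\<gamma> < 1" and F: "F = objective_discounted \<pi> P \<gamma>"
      and \<beta>: "\<forall>j\<in>{1..n - 1}. \<beta> j = \<eta> j / (1 - \<gamma> * \<eta> j)"
    \<comment> \<open>Since \<open>\<eta> j \<le> 1\<close>, the product is at most \<gamma>. This
      makes the geometric series converge and keeps the denominators positive.\<close>
    have lt1: "\<gamma> * \<eta> j < 1" if "j \<in> I" for j
      using mult_left_le[OF \<eta>01(2)[OF that] \<gamma>(1)] \<gamma>(2) by linarith
    have "(\<lambda>t. \<Sum>j\<in>I. \<gamma> ^ t * (\<eta> j ^ Suc t * a j)) sums (\<Sum>j\<in>I. \<beta> j * a j)"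
    proof (rule sums_sum)
      fix j assume j: "j \<in> I"
      have "(\<lambda>t. (\<gamma> * \<eta> j) ^ t) sums (1 / (1 - \<gamma> * \<eta> j))"
        using lt1[OF j] \<gamma> \<eta>01[OF j] by (intro geometric_sums) simp
      \<comment> \<open>The series starts at \<open>t = 0\<close> with one step of the chain already
        taken; the exponent \<open>Suc t\<close> supplies the extra factor
        \<open>\<eta> j\<close>.\<close>
      from sums_mult[OF this, of "\<eta> j * a j"]
      show "(\<lambda>t. \<gamma> ^ t * (\<eta> j ^ Suc t * a j)) sums (\<beta> j * a j)"
        using \<beta> j by (simp add: I_def power_mult_distrib mult_ac)
    qed
    then have "F \<O> = (\<Sum>j\<in>I. \<beta> j * a j)"
      by (simp add: F objective_discounted_def G_def[symmetric] step sum_distrib_left sums_iff)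
    moreover have "mono_on I \<beta>"
    proof (rule mono_onI)
      fix i j assume ij: "i \<in> I" "j \<in> I" "i \<le> j"
      then have "\<eta> i \<le> \<eta> j" using mono\<eta> by (auto simp: mono_on_def)
      \<comment> \<open>As \<eta> grows, the numerator grows and the positive denominator
        shrinks.\<close>
      then have "\<eta> i / (1 - \<gamma> * \<eta> i) \<le> \<eta> j / (1 - \<gamma> * \<eta> j)"
        using \<eta>01 lt1 \<gamma> ij by (intro frac_le) (auto intro: mult_left_mono)
      with \<beta> ij show "\<beta> i \<le> \<beta> j" by (simp add: I_def)
    qed
    ultimately show "F \<O> = (\<Sum>j\<in>I. \<beta> j * a j) \<and> mono_on I \<beta>" ..
  qed
  show "L + g * dispersion \<pi> \<phi> k \<O> \<le> F \<O> \<and> F \<O> \<le> L + W * dispersion \<pi> \<phi> k \<O>"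
    using weighted_sum_bounds[OF k mono\<beta>[unfolded I_def] a01[unfolded I_def] total[unfolded I_def] \<delta>]
    by (simp add: F L g W I_def)
qed

end
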